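(* For every integer $n \geq 2$, the following polynomial identity in $x$ holds: $$\sum_{k=1}^{n-1} (n-k)\,E(n-1,k-1)\,x^{k-1}=\sum_{\ell=1}^{n-1} O_2(n,\ell)\,(x-1)^{n-\ell-1}.$$
   Context: For $m \geq 1$ and $j \geq 0$, $E(m,j)$ denotes the Eulerian number: the number of permutations $\pi=\pi_1\cdots\pi_m$ of $[m]=\{1,\ldots,m\}$ (in one-line notation) with exactly $j$ ascents, where an ascent is an index $i \in [m-1]$ with $\pi_i<\pi_{i+1}$. For $n,\ell \geq 1$, $O_2(n,\ell)$ denotes the number of ordered partitions of $[n]$ into $\ell$ non-empty blocks (i.e. sequences $(P_1,\ldots,P_\ell)$ of non-empty pairwise disjoint sets with union $[n]$) in which the first block $P_1$ has size at least $2$. *)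

theory Defs
  imports
    "HOL-Computational_Algebra.Polynomial"
    "HOL-Combinatorics.Multiset_Permutations"
    "HOL-Library.Disjoint_Sets"
begin

(* A permutation of {1..m} in one-line notation is a list, indexed from 0: the i-th
   letter (i = 1, ..., m) is xs ! (i - 1), which only shifts the indices of ascents. *)

definition ascents :: "nat list \<Rightarrow> nat set" where
  "ascents xs = {i. Suc i < length xs \<and> xs ! i < xs ! Suc i}"

definition eulerian :: "nat \<Rightarrow> nat \<Rightarrow> nat" where
  "eulerian m j = card {xs \<in> permutations_of_set {1..m}. card (ascents xs) = j}"

definition ordered_partitions :: "nat \<Rightarrow> nat \<Rightarrow> nat set list set" where
  "ordered_partitions n l =
     {Ps. length Ps = l \<and> (\<forall>P \<in> set Ps. P \<noteq> {}) \<and>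
          disjoint_family_on (\<lambda>i. Ps ! i) {..<l} \<and> \<Union>(set Ps) = {1..n}}"

definition O2 :: "nat \<Rightarrow> nat \<Rightarrow> nat" where
  "O2 n l = card {Ps \<in> ordered_partitions n l. card (hd Ps) \<ge> 2}"

(* card is 0 on infinite sets, so the counts above rely on finiteness. *)

lemma finite_ascents: "finite (ascents xs)"
  by (rule finite_subset[of _ "{..<length xs}"]) (auto simp: ascents_def)

lemma finite_ordered_partitions: "finite (ordered_partitions n l)"
proof (rule finite_subset)
  show "ordered_partitions n l \<subseteq> {Ps. set Ps \<subseteq> Pow {1..n} \<and> length Ps = l}"
    by (auto simp: ordered_partitions_def)
  show "finite {Ps. set Ps \<subseteq> Pow {1..n} \<and> length Ps = l}"
    by (rule finite_lists_length_eq) simp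
qed

end

theory Submission
  imports Defs "HOL-Combinatorics.Stirling"
begin

text \<open>
  Put \<open>m = n - 1\<close> and let \<open>A\<^sub>m\<close> be the polynomial \<open>\<Sum>\<^sub>\<pi> x^asc \<pi>\<close>. Inserting the letter \<open>m + 1\<close> into
  \<open>\<pi>\<close> leaves the number \<open>a\<close> of ascents unchanged in \<open>a + 1\<close> positions and raises it by one in the
  remaining \<open>m - a\<close>, so \<open>A\<^sub>n - n A\<^sub>m = (x - 1) L\<close>, where \<open>L = \<Sum>\<^sub>\<pi> (m - a) x^a\<close> is the left-hand side.
  Since \<open>L = m A\<^sub>m - x A\<^sub>m'\<close>, this is a recurrence for \<open>A\<^sub>m\<close>, which the recurrence of the Stirling
  numbers gives for \<open>\<Sum>\<^sub>l l! S(m,l) (x - 1)^(m-l)\<close> as well; so the two agree (Frobenius).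
  Removing a singleton first block shows \<open>O\<^sub>2(n,l) = l! S(n,l) - n (l-1)! S(n-1,l-1)\<close>, hence
  \<open>x - 1\<close> times the right-hand side is also \<open>A\<^sub>n - n A\<^sub>m\<close>.
\<close>

section \<open>Inserting the largest letter into a permutation\<close>

lemma ascents_Nil [simp]: "ascents [] = {}"
  and ascents_single [simp]: "ascents [x] = {}"
  by (auto simp: ascents_def)

lemma ascents_Cons_Cons:
  "ascents (x # y # zs) = (if x < y then {0} else {}) \<union> Suc ` ascents (y # zs)"
proof (rule set_eqI)
  fix i
  show "i \<in> ascents (x # y # zs) \<longleftrightarrow> i \<in> (if x < y then {0} else {}) \<union> Suc ` ascents (y # zs)"
    by (cases i) (auto simp: ascents_def)
qed

lemma card_ascents_Cons_Cons:
  "card (ascents (x # y # zs)) = (if x < y then Suc (card (ascents (y # zs))) else card (ascents (y # zs)))"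
  by (auto simp: ascents_Cons_Cons card_insert_if finite_ascents card_image)

lemma card_ascents_less: "xs \<noteq> [] \<Longrightarrow> card (ascents xs) < length xs"
  by (induction xs rule: induct_list012) (auto simp: card_ascents_Cons_Cons)

lemma card_ascents_le: "card (ascents xs) \<le> length xs"
  by (cases "xs = []") (auto dest: card_ascents_less)

definition insert_at :: "nat \<Rightarrow> 'a \<Rightarrow> 'a list \<Rightarrow> 'a list" where
  "insert_at p M xs = take p xs @ M # drop p xs"

lemma insert_at_0: "insert_at 0 M xs = M # xs"
  and insert_at_Suc: "insert_at (Suc p) M (x # xs) = x # insert_at p M xs"
  by (auto simp: insert_at_def)

text \<open>A maximal letter placed in front or inside an ascent leaves the number of ascents alone;
  inside a pair that is not an ascent, or at the end of a non-empty word, it creates one more. The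
  induction peels off the first letter.\<close>

lemma sum_ascents_insert_max:
  fixes X :: "'a :: comm_ring_1"
  assumes "\<forall>x \<in> set xs. x < M"
  defines "a \<equiv> card (ascents xs)"
  shows "(\<Sum>p\<le>length xs. X ^ card (ascents (insert_at p M xs))) =
         of_nat (Suc a) * X ^ a + of_nat (length xs - a) * X ^ Suc a"
  using assms(1) unfolding a_def
proof (induction xs)
  case Nil
  then show ?case by (simp add: insert_at_def)
next
  case (Cons x xs)
  show ?case
  proof (cases xs)
    case Nil
    with Cons.prems show ?thesis
      by (simp add: insert_at_0 insert_at_Suc card_ascents_Cons_Cons)
  next
    case (Cons y ys)
    define b where "b = card (ascents xs)"
    define d :: nat where "d = (if x < y then 1 else 0)"
    have b_less: "b < length xs"
      using card_ascents_less[of xs] Cons by (simp add: b_def)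
    have M: "x < M" "\<not> M < x" "y < M" "\<not> M < y"
      using Cons.prems Cons by auto
    have asc: "card (ascents (x # xs)) = d + b"
      by (simp add: Cons card_ascents_Cons_Cons d_def b_def)
    have first: "card (ascents (insert_at 0 M xs)) = b"
      using M by (simp add: Cons card_ascents_Cons_Cons b_def insert_at_0)
    \<comment> \<open>Past the first position \<open>y\<close> still follows \<open>x\<close>, so
      this pair keeps its contribution \<open>d\<close>.\<close>
    have later: "card (ascents (x # insert_at (Suc p) M xs)) = d + card (ascents (insert_at (Suc p) M xs))" for p
      by (simp add: Cons insert_at_Suc card_ascents_Cons_Cons d_def)
    \<comment> \<open>The induction hypothesis without its term \<open>p = 0\<close>, which equals
      \<open>X ^ b\<close>; hence the coefficient \<open>b\<close> instead of
      \<open>Suc b\<close>.\<close>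
    have IH: "(\<Sum>p<length xs. X ^ card (ascents (insert_at (Suc p) M xs))) =
              of_nat b * X ^ b + of_nat (length xs - b) * X ^ Suc b"
    proof -
      have "(\<Sum>p\<le>length xs. X ^ card (ascents (insert_at p M xs))) =
            of_nat (Suc b) * X ^ b + of_nat (length xs - b) * X ^ Suc b"
        unfolding b_def by (rule Cons.IH) (use Cons.prems in auto)
      then show ?thesis
        unfolding sum.atMost_shift first by (simp add: algebra_simps)
    qed
    have "(\<Sum>p\<le>length (x # xs). X ^ card (ascents (insert_at p M (x # xs)))) =
          X ^ card (ascents (insert_at 0 M (x # xs))) +
          (\<Sum>p\<le>length xs. X ^ card (ascents (insert_at (Suc p) M (x # xs))))"
      by (simp only: list.size add_Suc_right add_0_right sum.atMost_Suc_shift)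
    also have "card (ascents (insert_at 0 M (x # xs))) = d + b"
      using M by (simp add: asc card_ascents_Cons_Cons insert_at_0)
    \<comment> \<open>Between \<open>x\<close> and \<open>y\<close> the letter \<open>M\<close>
      makes exactly one ascent whatever \<open>d\<close> is, hence the separate term
      \<open>X ^ Suc b\<close>.\<close>
    also have "(\<Sum>p\<le>length xs. X ^ card (ascents (insert_at (Suc p) M (x # xs)))) =
        X ^ Suc b + X ^ d * (of_nat b * X ^ b + of_nat (length xs - b) * X ^ Suc b)"
      unfolding insert_at_Suc sum.atMost_shift later power_add sum_distrib_left[symmetric] IH
      using M by (simp add: insert_at_0 card_ascents_Cons_Cons b_def Cons)
    also have "X ^ (d + b) + \<dots> = of_nat (Suc (d + b)) * X ^ (d + b) +
        of_nat (length (x # xs) - (d + b)) * X ^ Suc (d + b)"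
      using b_less by (auto simp: d_def of_nat_diff algebra_simps)
    finally show ?thesis
      unfolding asc .
  qed
qed

text \<open>Insertion is a bijection: deleting \<open>M\<close> and recording how many letters
  precede it recovers the pair \<open>(xs, p)\<close>.\<close>

lemma sum_permutations_of_set_insert:
  fixes g :: "'a list \<Rightarrow> 'b :: comm_monoid_add"
  assumes "M \<notin> A"
  shows "(\<Sum>xs\<in>permutations_of_set (insert M A). g xs) =
         (\<Sum>xs\<in>permutations_of_set A. \<Sum>p\<le>length xs. g (insert_at p M xs))"
proof -
  define inv where "inv ys = (remove1 M ys, length (takeWhile (\<lambda>y. y \<noteq> M) ys))" for ys :: "'a list"
  have inv_append: "inv (us @ M # vs) = (us @ vs, length us)" if "M \<notin> set us" for us vs
  proof -
    have "takeWhile (\<lambda>y. y \<noteq> M) (us @ M # vs) = us"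
      using that by (induction us) auto
    with that show ?thesis
      by (simp add: inv_def remove1_append)
  qed
  have "(\<Sum>xs\<in>permutations_of_set A. \<Sum>p\<le>length xs. g (insert_at p M xs)) =
        (\<Sum>(xs, p)\<in>(SIGMA xs:permutations_of_set A. {..length xs}). g (insert_at p M xs))"
    by (subst sum.Sigma) auto
  also have "\<dots> = (\<Sum>xs\<in>permutations_of_set (insert M A). g xs)"
  \<comment> \<open>Goals in order: \<open>inv\<close> undoes insertion, insertion lands in the
    permutations, insertion undoes \<open>inv\<close>, \<open>inv\<close> lands in the pairs, the
    summands agree.\<close>
  proof (rule sum.reindex_bij_witness[of _ inv "\<lambda>(xs, p). insert_at p M xs"], goal_cases)
    case (1 q)
    then obtain xs p where q: "q = (xs, p)" "set xs = A" "p \<le> length xs"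
      by (auto simp: permutations_of_set_def)
    with assms have "M \<notin> set (take p xs)"
      by (auto dest: in_set_takeD)
    with q show ?case
      by (simp add: insert_at_def inv_append)
  next
    case (2 q)
    then obtain xs p where q: "q = (xs, p)" "set xs = A" "distinct xs" "p \<le> length xs"
      by (auto simp: permutations_of_set_def)
    have "distinct (take p xs @ drop p xs)" "set (take p xs @ drop p xs) = A"
      using q by simp_all
    with assms q show ?case
      by (simp add: permutations_of_set_def insert_at_def del: append_take_drop_id) auto
  next
    case (3 ys)
    then obtain us vs where "ys = us @ M # vs" "M \<notin> set us"
      by (metis insertI1 permutations_of_setD(1) split_list_first)
    then show ?case
      by (simp add: inv_append insert_at_def)
  next
    case (4 ys)
    then obtain us vs where ys: "ys = us @ M # vs" "M \<notin> set us"
      by (metis insertI1 permutations_of_setD(1) split_list_first)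
    with 4 assms show ?case
      by (auto simp: inv_append permutations_of_set_def)
  next
    case (5 q)
    then show ?case by (auto simp: case_prod_unfold)
  qed
  finally show ?thesis ..
qed

section \<open>Eulerian polynomials\<close>

definition eulerian_poly :: "nat \<Rightarrow> int poly" where
  "eulerian_poly m = (\<Sum>xs\<in>permutations_of_set {1..m}. monom 1 1 ^ card (ascents xs))"

text \<open>The left-hand side of the identity for \<open>n = m + 1\<close>, summed over words. The
  weight counts the positions at which the new letter \<open>m + 1\<close> creates an
  ascent.\<close>

definition eulerian_weighted :: "nat \<Rightarrow> int poly" where
  "eulerian_weighted m =
     (\<Sum>xs\<in>permutations_of_set {1..m}. of_nat (m - card (ascents xs)) * monom 1 1 ^ card (ascents xs))"

lemma eulerian_poly_Suc:
  "eulerian_poly (Suc m) =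
     of_nat (Suc m) * eulerian_poly m + (monom 1 1 - 1) * eulerian_weighted m"
proof -
  define X :: "int poly" where "X = monom 1 1"
  let ?a = "\<lambda>xs. card (ascents xs)"
  have "{1..Suc m} = insert (Suc m) {1..m}"
    by auto
  then have "eulerian_poly (Suc m) =
      (\<Sum>xs\<in>permutations_of_set {1..m}. \<Sum>p\<le>length xs. X ^ ?a (insert_at p (Suc m) xs))"
    by (simp add: eulerian_poly_def X_def sum_permutations_of_set_insert)
  \<comment> \<open>For \<open>a\<close> ascents, \<open>(a + 1) X^a + (m - a) X^(a + 1)\<close> is
    regrouped by \<open>(a + 1) + (m - a) = m + 1\<close>.\<close>
  also have "\<dots> = (\<Sum>xs\<in>permutations_of_set {1..m}.
      of_nat (Suc m) * X ^ ?a xs + (X - 1) * (of_nat (m - ?a xs) * X ^ ?a xs))"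
  proof (rule sum.cong)
    fix xs assume xs: "xs \<in> permutations_of_set {1..m}"
    then have len: "length xs = m"
      using length_finite_permutations_of_set by fastforce
    have "?a xs \<le> m"
      using card_ascents_le[of xs] len by simp
    moreover have "\<forall>x \<in> set xs. x < Suc m"
      using xs by (auto simp: permutations_of_set_def)
    ultimately show "(\<Sum>p\<le>length xs. X ^ ?a (insert_at p (Suc m) xs)) =
        of_nat (Suc m) * X ^ ?a xs + (X - 1) * (of_nat (m - ?a xs) * X ^ ?a xs)"
      using sum_ascents_insert_max[of xs "Suc m" X] by (simp add: len of_nat_diff algebra_simps)
  qed simp
  finally show ?thesis
    by (simp add: eulerian_poly_def eulerian_weighted_def X_def sum.distrib sum_distrib_left)
qed

section \<open>Derivative form and coefficients of the weighted Eulerian polynomial\<close>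

lemma pderiv_sum: "pderiv (\<Sum>x\<in>A. f x) = (\<Sum>x\<in>A. pderiv (f x))"
  using higher_pderiv_sum[of 1 f A] by simp

text \<open>Both \<open>monom 1 1\<close> and \<open>monom 1 1 - 1\<close> have derivative 1, so the
  same Euler operator argument serves the Eulerian and the Stirling recurrence.\<close>

lemma mult_pderiv_power:
  fixes p :: "'a :: idom poly"
  assumes "pderiv p = 1"
  shows "p * pderiv (p ^ k) = of_nat k * p ^ k"
  unfolding pderiv_power assms of_nat_mult_conv_smult by (cases k) auto

lemma pderiv_monom_1 [simp]: "pderiv (monom 1 (Suc 0)) = (1 :: 'a :: idom poly)"
  by (simp add: pderiv_monom)

text \<open>The operator \<open>X * pderiv\<close> brings down the number of ascents as a factor.
  This frees the recurrence for \<open>eulerian_poly\<close> from any reference to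
  permutations.\<close>

lemma eulerian_weighted_eq:
  "eulerian_weighted m = of_nat m * eulerian_poly m - monom 1 1 * pderiv (eulerian_poly m)"
proof -
  define X :: "int poly" where "X = monom 1 1"
  have [simp]: "pderiv X = 1"
    by (simp add: X_def)
  have "of_nat (m - card (ascents xs)) * X ^ card (ascents xs) =
        of_nat m * X ^ card (ascents xs) - X * pderiv (X ^ card (ascents xs))"
    if "xs \<in> permutations_of_set {1..m}" for xs
  proof -
    have "length xs = m"
      using that length_finite_permutations_of_set by fastforce
    with card_ascents_le[of xs] show ?thesis
      by (simp add: mult_pderiv_power of_nat_diff algebra_simps)
  qed
  then show ?thesis
    by (simp add: eulerian_weighted_def eulerian_poly_def pderiv_sum sum_distrib_left
        sum_subtractf flip: X_def del: One_nat_def)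
qed

text \<open>Words are grouped by their number of ascents; a non-empty word of length
  \<open>m\<close> has fewer than \<open>m\<close>, so \<open>j < m\<close> covers every
  group.\<close>

lemma eulerian_weighted_altdef:
  assumes "m \<ge> 1"
  shows "eulerian_weighted m = (\<Sum>j<m. of_nat ((m - j) * eulerian m j) * monom 1 1 ^ j)"
proof -
  let ?S = "permutations_of_set {1..m}"
  have less: "card (ascents xs) < m" if "xs \<in> ?S" for xs
  proof -
    have "length xs = m"
      using that length_finite_permutations_of_set by fastforce
    moreover from this assms have "xs \<noteq> []"
      by auto
    ultimately show ?thesis
      using card_ascents_less by blast
  qed
  have "eulerian_weighted m = (\<Sum>j<m. \<Sum>xs | xs \<in> ?S \<and> card (ascents xs) = j.
          of_nat (m - card (ascents xs)) * monom 1 1 ^ card (ascents xs))"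
    unfolding eulerian_weighted_def by (rule sum.group[symmetric]) (auto simp: less)
  also have "\<dots> = (\<Sum>j<m. of_nat ((m - j) * eulerian m j) * monom 1 1 ^ j)"
    by (intro sum.cong refl) (simp add: eulerian_def algebra_simps)
  finally show ?thesis .
qed

section \<open>Frobenius' formula\<close>

text \<open>The coefficient \<open>fact l * Stirling n l\<close> is the number of ordered partitions
  of an \<open>n\<close>-set into \<open>l\<close> blocks.\<close>

definition frobenius_poly :: "nat \<Rightarrow> int poly" where
  "frobenius_poly n = (\<Sum>l\<le>n. of_nat (fact l * Stirling n l) * (monom 1 1 - 1) ^ (n - l))"

text \<open>The coefficients satisfy the recurrence \<open>F_Suc\<close> of surjection numbers; the
  factor \<open>l\<close> in it is expressed through the derivative, acting on powers of
  \<open>X - 1\<close>.\<close>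

lemma frobenius_poly_Suc:
  "frobenius_poly (Suc n) = frobenius_poly n +
     monom 1 1 * (of_nat n * frobenius_poly n - (monom 1 1 - 1) * pderiv (frobenius_poly n))"
proof -
  define Y :: "int poly" where "Y = monom 1 1 - 1"
  define F where "F n l = (of_nat (fact l * Stirling n l) :: int poly)" for n l
  have [simp]: "pderiv Y = 1"
    by (simp add: Y_def pderiv_diff)
  have X: "monom 1 1 = Y + 1"
    by (simp add: Y_def)
  have F_Suc: "F (Suc n) (Suc l) = of_nat (Suc l) * (F n l + F n (Suc l))" for l
    by (simp add: F_def algebra_simps)
  \<comment> \<open>\<open>F n l\<close> is a constant polynomial.\<close>
  have pd: "pderiv (F n l * p) = F n l * pderiv p" for l p
    by (simp only: F_def pderiv_mult pderiv_of_nat mult_zero_right add_0_right)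
  \<comment> \<open>\<open>Y * pderiv\<close> multiplies \<open>Y ^ (n - l)\<close> by \<open>n - l\<close>, so this operator weights the \<open>l\<close>-th term by \<open>l\<close>.\<close>
  have weighted: "of_nat n * frobenius_poly n - Y * pderiv (frobenius_poly n) =
      (\<Sum>l\<le>n. of_nat l * F n l * Y ^ (n - l))"
  proof -
    have "of_nat n * frobenius_poly n - Y * pderiv (frobenius_poly n) =
        (\<Sum>l\<le>n. F n l * (of_nat n * Y ^ (n - l) - Y * pderiv (Y ^ (n - l))))"
      by (simp add: frobenius_poly_def pderiv_sum pd sum_distrib_left sum_subtractf algebra_simps
          flip: Y_def F_def del: One_nat_def of_nat_mult)
    also have "\<dots> = (\<Sum>l\<le>n. of_nat l * F n l * Y ^ (n - l))"
      by (intro sum.cong refl) (simp add: mult_pderiv_power of_nat_diff algebra_simps)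
    finally show ?thesis .
  qed
  have "frobenius_poly (Suc n) = (\<Sum>l\<le>Suc n. F (Suc n) l * Y ^ (Suc n - l))"
    by (simp only: frobenius_poly_def F_def Y_def)
  also have "\<dots> = (\<Sum>l\<le>n. F (Suc n) (Suc l) * Y ^ (n - l))"
    by (subst sum.atMost_Suc_shift) (simp add: F_def)
  also have "\<dots> = (\<Sum>l\<le>n. of_nat (Suc l) * F n l * Y ^ (n - l)) +
                  (\<Sum>l\<le>n. of_nat (Suc l) * F n (Suc l) * Y ^ (n - l))"
    by (simp only: F_Suc distrib_left distrib_right sum.distrib mult.assoc)
  \<comment> \<open>Shifting the index back adds a term \<open>l = 0\<close> of weight 0; next, the
    top term goes since \<open>Stirling n (Suc n) = 0\<close>. For the remaining \<open>l\<close>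
    the exponent is positive, which frees a factor \<open>Y\<close>.\<close>
  also have "(\<Sum>l\<le>n. of_nat (Suc l) * F n (Suc l) * Y ^ (n - l)) =
             (\<Sum>l\<le>Suc n. of_nat l * F n l * Y ^ (Suc n - l))"
    by (subst sum.atMost_Suc_shift) simp
  also have "\<dots> = (\<Sum>l\<le>n. of_nat l * F n l * Y ^ (Suc n - l))"
    by (simp add: F_def)
  also have "\<dots> = Y * (\<Sum>l\<le>n. of_nat l * F n l * Y ^ (n - l))"
    unfolding sum_distrib_left by (intro sum.cong refl) (simp add: Suc_diff_le mult_ac)
  also have "(\<Sum>l\<le>n. of_nat (Suc l) * F n l * Y ^ (n - l)) =
      frobenius_poly n + (\<Sum>l\<le>n. of_nat l * F n l * Y ^ (n - l))"
    by (simp add: frobenius_poly_def algebra_simps sum.distrib flip: Y_def F_def del: One_nat_def of_nat_mult)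
  \<comment> \<open>The weighted sum now occurs once plain and once times \<open>Y\<close>, and
    \<open>1 + Y\<close> is \<open>monom 1 1\<close>.\<close>
  finally show ?thesis
    unfolding X weighted[symmetric] by (simp add: algebra_simps)
qed

text \<open>Both families start at 1, and their recurrences coincide once expanded: with
  \<open>A\<close> for the polynomial, \<open>(n + 1) A + (X - 1) n A = A + n X A\<close>, and both
  subtract \<open>X (X - 1) A'\<close>.\<close>

lemma eulerian_poly_eq_frobenius_poly: "eulerian_poly n = frobenius_poly n"
proof (induction n)
  case 0
  show ?case by (simp add: eulerian_poly_def frobenius_poly_def)
next
  case (Suc n)
  show ?case
    by (simp add: eulerian_poly_Suc eulerian_weighted_eq Suc.IH frobenius_poly_Suc algebra_simps)
qed

section \<open>Counting ordered partitions\<close>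

text \<open>Extensional functions are used so that a map on \<open>A\<close> is counted only once,
  with \<open>undefined\<close> as its value elsewhere.\<close>

definition surjections :: "'a set \<Rightarrow> 'b set \<Rightarrow> ('a \<Rightarrow> 'b) set" where
  "surjections A B = {f \<in> A \<rightarrow>\<^sub>E B. f ` A = B}"

lemma finite_surjections: "finite A \<Longrightarrow> finite B \<Longrightarrow> finite (surjections A B)"
  unfolding surjections_def by (rule finite_subset[of _ "A \<rightarrow>\<^sub>E B"]) (auto intro: finite_PiE)

section \<open>Surjections and Stirling numbers\<close>

lemma inj_on_fun_upd_PiE: "a \<notin> A \<Longrightarrow> inj_on (\<lambda>f. f(a := i)) (A \<rightarrow>\<^sub>E B)"
  by (rule inj_onI, rule ext) (metis PiE_arb fun_upd_other)

lemma PiE_restrict_remove: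
  assumes "f \<in> insert a A \<rightarrow>\<^sub>E B" "a \<notin> A"
  shows "f(a := undefined) \<in> extensional A" "(f(a := undefined)) ` A = f ` A"
    "(f(a := undefined))(a := f a) = f"
  using assms by (auto simp: PiE_def extensional_def)

text \<open>Once \<open>a\<close> is sent to \<open>i\<close>, the values on \<open>A\<close> must
  cover \<open>B\<close> except possibly \<open>i\<close>: they either hit \<open>i\<close> again or
  miss exactly \<open>i\<close>.\<close>

lemma surjections_insert_value:
  assumes "a \<notin> A" "i \<in> B"
  shows "{f \<in> surjections (insert a A) B. f a = i} =
         (\<lambda>f. f(a := i)) ` (surjections A B \<union> surjections A (B - {i}))"
proof (intro equalityI subsetI)
  fix f assume f: "f \<in> {f \<in> surjections (insert a A) B. f a = i}"
  then have r: "f(a := undefined) \<in> extensional A" "(f(a := undefined)) ` A = f ` A"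
      "(f(a := undefined))(a := i) = f"
    using PiE_restrict_remove[of f a A B] assms by (auto simp: surjections_def)
  have "insert i (f ` A) = B"
    using f by (auto simp: surjections_def)
  then have "f ` A = B \<or> f ` A = B - {i}"
    by auto
  then have "f(a := undefined) \<in> surjections A B \<union> surjections A (B - {i})"
    using r(1,2) by (auto simp: surjections_def PiE_def Pi_def)
  with r(3) show "f \<in> (\<lambda>f. f(a := i)) ` (surjections A B \<union> surjections A (B - {i}))"
    by (metis image_eqI)
next
  fix f assume "f \<in> (\<lambda>f. f(a := i)) ` (surjections A B \<union> surjections A (B - {i}))"
  then obtain g where g: "f = g(a := i)" "g \<in> extensional A" "g ` A = B \<or> g ` A = B - {i}"
    by (auto simp: surjections_def PiE_def)
  have "f ` A = g ` A"
    using g(1) assms by (auto simp: image_iff)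
  then have "f ` insert a A = B"
    using g assms by auto
  moreover have "f \<in> extensional (insert a A)"
    using g by (auto simp: extensional_def)
  ultimately show "f \<in> {f \<in> surjections (insert a A) B. f a = i}"
    using g(1) unfolding surjections_def PiE_def by auto
qed

lemma surjections_subset_PiE: "B \<subseteq> C \<Longrightarrow> surjections A B \<subseteq> A \<rightarrow>\<^sub>E C"
  by (auto simp: surjections_def PiE_def Pi_def)

text \<open>Induction on the domain, sorting the maps by the value at the new element; all values in
  \<open>B\<close> contribute equally.\<close>

lemma card_surjections:
  assumes "finite A" "finite B"
  shows "card (surjections A B) = fact (card B) * Stirling (card A) (card B)"
  using assms
proof (induction A arbitrary: B rule: finite_induct)
  case empty
  show ?case
  proof (cases "B = {}")
    case True
    then have "surjections ({} :: 'a set) B = {\<lambda>_. undefined}"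
      by (auto simp: surjections_def)
    then show ?thesis
      using True by simp
  next
    case False
    then have "surjections ({} :: 'a set) B = {}"
      by (auto simp: surjections_def)
    moreover have "card B \<noteq> 0"
      using False empty by simp
    then have "Stirling 0 (card B) = 0"
      by (cases "card B") auto
    ultimately show ?thesis
      by simp
  qed
next
  case (insert a A)
  have fiber: "card {f \<in> surjections (insert a A) B. f a = i} =
      fact (card B) * Stirling (card A) (card B) +
      fact (card B - 1) * Stirling (card A) (card B - 1)" if "i \<in> B" for i
  proof -
    have "surjections A B \<union> surjections A (B - {i}) \<subseteq> A \<rightarrow>\<^sub>E B"
      by (auto dest!: surjections_subset_PiE[THEN subsetD, rotated])
    then have "card {f \<in> surjections (insert a A) B. f a = i} =
        card (surjections A B \<union> surjections A (B - {i}))"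
      using insert.hyps that
      by (simp add: surjections_insert_value card_image inj_on_subset[OF inj_on_fun_upd_PiE])
    \<comment> \<open>Disjoint because the images \<open>B\<close> and \<open>B - {i}\<close>
      differ.\<close>
    also have "\<dots> = card (surjections A B) + card (surjections A (B - {i}))"
      using insert.hyps insert.prems that
      by (intro card_Un_disjoint finite_surjections) (auto simp: surjections_def)
    also have "\<dots> = fact (card B) * Stirling (card A) (card B) +
        fact (card B - 1) * Stirling (card A) (card B - 1)"
      using insert.prems that by (simp add: insert.IH)
    finally show ?thesis .
  qed
  have "surjections (insert a A) B = (\<Union>i\<in>B. {f \<in> surjections (insert a A) B. f a = i})"
    by (auto simp: surjections_def)
  then have "card (surjections (insert a A) B) =
      card (\<Union>i\<in>B. {f \<in> surjections (insert a A) B. f a = i})"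
    by (rule arg_cong)
  also have "\<dots> = (\<Sum>i\<in>B. card {f \<in> surjections (insert a A) B. f a = i})"
    using insert.hyps insert.prems by (intro card_UN_disjoint) (auto simp: finite_surjections)
  also have "\<dots> = card B * (fact (card B) * Stirling (card A) (card B) +
      fact (card B - 1) * Stirling (card A) (card B - 1))"
    using fiber by simp
  \<comment> \<open>The Stirling recurrence. For empty \<open>B\<close> the truncated
    \<open>card B - 1\<close> is multiplied by 0, and the Stirling number on the right vanishes
    too.\<close>
  also have "\<dots> = fact (card B) * Stirling (card (insert a A)) (card B)"
    using insert.hyps by (cases "card B") (auto simp: algebra_simps)
  finally show ?case .
qed

text \<open>Deleting \<open>a\<close> leaves an arbitrary surjection of the other elements onto
  \<open>B - {i}\<close>, from which the map is restored uniquely.\<close>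

lemma card_surjections_singleton_fiber:
  assumes "finite A" "finite B" "a \<in> A" "i \<in> B"
  shows "card {f \<in> surjections A B. {x \<in> A. f x = i} = {a}} =
         fact (card B - 1) * Stirling (card A - 1) (card B - 1)"
proof -
  define A' where "A' = A - {a}"
  have A: "A = insert a A'" "a \<notin> A'" "finite A'"
    using assms by (auto simp: A'_def)
  have "{f \<in> surjections A B. {x \<in> A. f x = i} = {a}} = (\<lambda>f. f(a := i)) ` surjections A' (B - {i})"
  proof (intro equalityI subsetI)
    fix f assume f: "f \<in> {f \<in> surjections A B. {x \<in> A. f x = i} = {a}}"
    then have fa: "f a = i"
      by auto
    have "f \<in> {f \<in> surjections (insert a A') B. f a = i}"
      using f fa A by auto
    then obtain g where g: "f = g(a := i)" "g \<in> surjections A' B \<union> surjections A' (B - {i})"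
      using surjections_insert_value[of a A' i B] A assms by blast
    have "g x \<noteq> i" if "x \<in> A'" for x
    proof -
      have "x \<noteq> a" "x \<in> A"
        using that A by auto
      with f have "f x \<noteq> i"
        by blast
      with g(1) \<open>x \<noteq> a\<close> show ?thesis
        by simp
    qed
    then have "i \<notin> g ` A'"
      by auto
    with g(2) assms(4) have "g \<in> surjections A' (B - {i})"
      by (auto simp: surjections_def)
    with g(1) show "f \<in> (\<lambda>f. f(a := i)) ` surjections A' (B - {i})"
      by blast
  next
    fix f assume "f \<in> (\<lambda>f. f(a := i)) ` surjections A' (B - {i})"
    then obtain g where g: "f = g(a := i)" "g \<in> surjections A' (B - {i})"
      by auto
    have "f \<in> {f \<in> surjections (insert a A') B. f a = i}"
      using surjections_insert_value[of a A' i B] A assms g by blast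
    moreover have "g x \<noteq> i" if "x \<in> A'" for x
      using g(2) that by (auto simp: surjections_def)
    ultimately show "f \<in> {f \<in> surjections A B. {x \<in> A. f x = i} = {a}}"
      using g(1) A by auto
  qed
  moreover have "surjections A' (B - {i}) \<subseteq> A' \<rightarrow>\<^sub>E B"
    by (rule surjections_subset_PiE) auto
  ultimately have "card {f \<in> surjections A B. {x \<in> A. f x = i} = {a}} = card (surjections A' (B - {i}))"
    using A by (simp add: card_image inj_on_subset[OF inj_on_fun_upd_PiE])
  with assms A show ?thesis
    by (simp add: card_surjections)
qed

text \<open>By surjectivity the fibre over \<open>i\<close> is non-empty, so it has at least two
  elements or is \<open>{a}\<close> for exactly one \<open>a\<close>, and each \<open>a\<close>
  contributes equally.\<close>

lemma card_surjections_split_fiber: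
  assumes "finite A" "finite B" "i \<in> B"
  shows "card (surjections A B) =
         card {f \<in> surjections A B. card {x \<in> A. f x = i} \<ge> 2} +
         card A * (fact (card B - 1) * Stirling (card A - 1) (card B - 1))"
proof -
  let ?fib = "\<lambda>f. {x \<in> A. f x = i}"
  let ?big = "{f \<in> surjections A B. card (?fib f) \<ge> 2}"
  let ?single = "\<lambda>a. {f \<in> surjections A B. ?fib f = {a}}"
  have fin: "finite (surjections A B)"
    using assms by (simp add: finite_surjections)
  have cover: "surjections A B = ?big \<union> (\<Union>a\<in>A. ?single a)"
  proof (intro equalityI subsetI)
    fix f assume f: "f \<in> surjections A B"
    then have "?fib f \<noteq> {}"
      using assms(3) by (auto simp: surjections_def)
    then have "card (?fib f) \<noteq> 0"
      using assms(1) by simp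
    then consider "card (?fib f) \<ge> 2" | "card (?fib f) = 1"
      by linarith
    then show "f \<in> ?big \<union> (\<Union>a\<in>A. ?single a)"
    proof cases
      case 2
      then obtain a where "?fib f = {a}"
        by (auto simp: card_1_singleton_iff)
      moreover from this have "a \<in> A"
        by blast
      ultimately show ?thesis
        using f by blast
    qed (use f in auto)
  qed auto
  have "card (surjections A B) = card ?big + card (\<Union>a\<in>A. ?single a)"
    using fin by (subst cover, subst card_Un_disjoint) (auto intro!: finite_subset[OF _ fin])
  also have "card (\<Union>a\<in>A. ?single a) = (\<Sum>a\<in>A. card (?single a))"
    using assms fin by (intro card_UN_disjoint) auto
  also have "\<dots> = card A * (fact (card B - 1) * Stirling (card A - 1) (card B - 1))"
    using assms by (simp add: card_surjections_singleton_fiber)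
  finally show ?thesis .
qed

text \<open>Blocks correspond to fibres: list position \<open>i\<close> holds the fibre over
  \<open>i\<close>, so the first block is the fibre over 0.\<close>

lemma card_ordered_partitions_hd:
  assumes "l \<ge> 1"
  shows "card {Ps \<in> ordered_partitions n l. Q (hd Ps)} =
         card {f \<in> surjections {1..n} {..<l}. Q {x \<in> {1..n}. f x = 0}}"
proof -
  define fibers where "fibers f = map (\<lambda>i. {x \<in> {1..n}. f x = i}) [0..<l]" for f :: "nat \<Rightarrow> nat"
  \<comment> \<open>The inverse of \<open>fibers\<close>. The description is well defined since the
    blocks cover \<open>{1..n}\<close> and are disjoint.\<close>
  define index where "index Ps = (\<lambda>x\<in>{1..n}. THE i. i < l \<and> x \<in> Ps ! i)" for Ps :: "nat set list"
  have index_eq: "index Ps x = i \<longleftrightarrow> x \<in> Ps ! i"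
    if Ps: "Ps \<in> ordered_partitions n l" and "x \<in> {1..n}" "i < l" for Ps x i
  proof -
    have unique: "j = k" if "j < l" "k < l" "x \<in> Ps ! j" "x \<in> Ps ! k" for j k
      using Ps that disjoint_family_onD[of "\<lambda>i. Ps ! i" "{..<l}" j k]
      by (auto simp: ordered_partitions_def)
    have "x \<in> \<Union> (set Ps)" "length Ps = l"
      using Ps \<open>x \<in> {1..n}\<close> by (auto simp: ordered_partitions_def)
    then obtain j where j: "j < l" "x \<in> Ps ! j"
      by (auto simp: in_set_conv_nth)
    then have "(THE i. i < l \<and> x \<in> Ps ! i) = j"
      using unique by blast
    then have "index Ps x = j"
      using \<open>x \<in> {1..n}\<close> by (simp add: index_def)
    then show ?thesis
      using j unique \<open>i < l\<close> by blast
  qed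
  have index_surj: "index Ps \<in> surjections {1..n} {..<l}" if Ps: "Ps \<in> ordered_partitions n l" for Ps
  proof -
    have len: "length Ps = l" and un: "\<Union> (set Ps) = {1..n}"
      and ne: "\<And>P. P \<in> set Ps \<Longrightarrow> P \<noteq> {}"
      using Ps by (auto simp: ordered_partitions_def)
    have "index Ps x < l" if "x \<in> {1..n}" for x
    proof -
      have "x \<in> \<Union> (set Ps)"
        using that un by simp
      then obtain j where "j < l" "x \<in> Ps ! j"
        using len by (auto simp: in_set_conv_nth)
      with index_eq[OF Ps that] show ?thesis
        by metis
    qed
    moreover have "i \<in> index Ps ` {1..n}" if "i < l" for i
    proof -
      have "Ps ! i \<in> set Ps"
        using that len by simp
      then obtain x where "x \<in> Ps ! i" "x \<in> {1..n}"
        using ne un by blast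
      then show ?thesis
        using index_eq[OF Ps _ that] by blast
    qed
    ultimately show ?thesis
      by (auto simp: surjections_def index_def)
  qed
  have fibers_index: "fibers (index Ps) = Ps" if Ps: "Ps \<in> ordered_partitions n l" for Ps
  proof (rule nth_equalityI)
    show "length (fibers (index Ps)) = length Ps"
      using Ps by (simp add: fibers_def ordered_partitions_def)
    fix i assume "i < length (fibers (index Ps))"
    then have "i < l" "Ps ! i \<subseteq> {1..n}"
      using Ps by (auto simp: fibers_def ordered_partitions_def)
    then show "fibers (index Ps) ! i = Ps ! i"
      using index_eq[OF Ps] by (auto simp: fibers_def)
  qed
  have fibers_partition: "fibers f \<in> ordered_partitions n l"
    if "f \<in> surjections {1..n} {..<l}" for f
  proof -
    have img: "f ` {1..n} = {..<l}"
      using that by (simp add: surjections_def)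
    have ex: "\<exists>x\<in>{1..n}. f x = i" if "i < l" for i
      using that img by (metis imageE lessThan_iff)
    have less: "f x < l" if "x \<in> {1..n}" for x
      using that img by blast
    have "{} \<notin> set (fibers f)"
      using ex by (fastforce simp: fibers_def)
    moreover have "disjoint_family_on (\<lambda>i. fibers f ! i) {..<l}"
      by (auto simp: disjoint_family_on_def fibers_def)
    moreover have "\<Union> (set (fibers f)) = {1..n}"
      using less by (auto simp: fibers_def)
    ultimately show ?thesis
      by (auto simp: ordered_partitions_def fibers_def)
  qed
  have index_fibers: "index (fibers f) = f" if f: "f \<in> surjections {1..n} {..<l}" for f
  proof
    fix x
    show "index (fibers f) x = f x"
    proof (cases "x \<in> {1..n}")
      case True
      then have "f x < l"
        using f by (auto simp: surjections_def)
      then show ?thesis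
        using index_eq[OF fibers_partition[OF f] True, of "f x"] True by (simp add: fibers_def)
    next
      \<comment> \<open>Outside the ground set both maps take the default value
        \<open>undefined\<close>.\<close>
      case False
      then show ?thesis
        using f PiE_arb[of f _ _ x] by (auto simp: index_def surjections_def)
    qed
  qed
  have hd_fibers: "hd (fibers f) = {x \<in> {1..n}. f x = 0}" for f
    using assms by (simp add: fibers_def hd_map)
  have "bij_betw fibers {f \<in> surjections {1..n} {..<l}. Q {x \<in> {1..n}. f x = 0}}
          {Ps \<in> ordered_partitions n l. Q (hd Ps)}"
    unfolding hd_fibers[symmetric]
    by (rule bij_betw_byWitness[where f' = index])
      (auto simp: index_fibers fibers_index fibers_partition index_surj simp del: One_nat_def)
  then show ?thesis
    by (simp add: bij_betw_same_card)
qed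

section \<open>Stirling form of \<open>O2\<close> and its generating polynomial\<close>

lemma O2_Stirling:
  assumes "l \<ge> 1"
  shows "O2 n l + n * (fact (l - 1) * Stirling (n - 1) (l - 1)) = fact l * Stirling n l"
  using assms card_surjections_split_fiber[of "{1..n}" "{..<l}" 0]
  by (simp add: O2_def card_ordered_partitions_hd[where Q = "\<lambda>P. 2 \<le> card P"] card_surjections)

text \<open>The factor \<open>X - 1\<close> raises the exponents to those in
  \<open>frobenius_poly\<close>; the two Stirling terms of \<open>O2_Stirling\<close> then sum to
  the two polynomials on the right.\<close>

lemma sum_O2:
  assumes "n \<ge> 1"
  shows "(monom 1 1 - 1) * (\<Sum>l = 1..n - 1. of_nat (O2 n l) * (monom 1 1 - 1) ^ (n - l - 1)) =
         frobenius_poly n - of_nat n * frobenius_poly (n - 1)"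
proof -
  define Y :: "int poly" where "Y = monom 1 1 - 1"
  define F where "F n l = (of_nat (fact l * Stirling n l) :: int poly)" for n l
  obtain m where n: "n = Suc m"
    using assms by (cases n) auto
  have O2: "of_nat (O2 n (Suc l)) = F n (Suc l) - of_nat n * F m l" for l
  proof -
    have "of_nat (O2 n (Suc l) + n * (fact l * Stirling m l)) = F n (Suc l)"
      using O2_Stirling[of "Suc l" n] unfolding F_def n by (simp only: diff_Suc_1)
    then show ?thesis
      by (simp add: F_def algebra_simps)
  qed
  \<comment> \<open>With \<open>n\<close> blocks all are singletons. This zero term later extends
    the sum from \<open>l < m\<close> to \<open>l \<le> m\<close>.\<close>
  have "O2 n n = 0"
    using O2_Stirling[of n n] n by (simp add: Stirling_same)
  then have last: "of_nat (O2 n (Suc m)) = (0 :: int poly)"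
    by (simp add: n)
  have "Y * (\<Sum>l = 1..n - 1. of_nat (O2 n l) * Y ^ (n - l - 1)) =
        Y * (\<Sum>l<m. of_nat (O2 n (Suc l)) * Y ^ (m - l - 1))"
    unfolding n by (simp add: sum.atLeast1_atMost_eq)
  also have "\<dots> = (\<Sum>l<m. of_nat (O2 n (Suc l)) * Y ^ (m - l))"
    unfolding sum_distrib_left
  proof (rule sum.cong)
    fix l assume "l \<in> {..<m}"
    then have "m - l = Suc (m - l - 1)"
      by simp
    then have "Y ^ (m - l) = Y * Y ^ (m - l - 1)"
      by (metis power_Suc)
    then show "Y * (of_nat (O2 n (Suc l)) * Y ^ (m - l - 1)) = of_nat (O2 n (Suc l)) * Y ^ (m - l)"
      by (simp only: mult_ac)
  qed simp
  also have "\<dots> = (\<Sum>l\<le>m. of_nat (O2 n (Suc l)) * Y ^ (m - l))"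
    by (simp add: last flip: lessThan_Suc_atMost)
  also have "\<dots> = (\<Sum>l\<le>m. F n (Suc l) * Y ^ (m - l)) - of_nat n * (\<Sum>l\<le>m. F m l * Y ^ (m - l))"
    by (simp add: O2 left_diff_distrib sum_subtractf sum_distrib_left mult.assoc)
  \<comment> \<open>The added term \<open>l = 0\<close> is zero because \<open>n\<close> is
    positive.\<close>
  also have "(\<Sum>l\<le>m. F n (Suc l) * Y ^ (m - l)) = (\<Sum>l\<le>n. F n l * Y ^ (n - l))"
    unfolding n by (subst sum.atMost_Suc_shift) (simp add: F_def)
  finally show ?thesis
    by (simp only: frobenius_poly_def F_def Y_def n diff_Suc_1)
qed

section \<open>Comparison of the two sides\<close>

theorem theorem1:
  fixes n :: nat and X :: "int poly"
  defines "X \<equiv> monom 1 1"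
  assumes "n \<ge> 2"
  shows "(\<Sum>k = 1..n - 1. of_nat ((n - k) * eulerian (n - 1) (k - 1)) * X ^ (k - 1)) =
         (\<Sum>l = 1..n - 1. of_nat (O2 n l) * (X - 1) ^ (n - l - 1))"
    (is "?lhs = ?rhs")
proof -
  obtain m where n: "n = Suc m" "m \<ge> 1"
    using assms(2) by (cases n) auto
  \<comment> \<open>Substitute \<open>j = k - 1\<close>, so that
    \<open>n - k = m - j\<close>.\<close>
  have "?lhs = eulerian_weighted m"
    unfolding n eulerian_weighted_altdef[OF n(2)] X_def by (simp add: sum.atLeast1_atMost_eq)
  \<comment> \<open>By Frobenius' formula both products equal
    \<open>eulerian_poly n - of_nat n * eulerian_poly m\<close>.\<close>
  moreover have "(X - 1) * eulerian_weighted m = (X - 1) * ?rhs"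
    using eulerian_poly_Suc[of m] sum_O2[of n] n
    by (auto simp: eulerian_poly_eq_frobenius_poly X_def)
  \<comment> \<open>Integer polynomials form an integral domain, so this allows cancelling
    \<open>X - 1\<close>.\<close>
  moreover have "X - 1 \<noteq> 0"
  proof
    assume "X - 1 = 0"
    then have "degree X = degree (1 :: int poly)"
      by simp
    then show False
      by (simp add: X_def degree_monom_eq)
  qed
  ultimately show ?thesis
    by simp
qed

end
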